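(* Let $(Q,\leq)$ be a well-quasi-order and let $N$ be a fixed positive integer. If $D_1, D_2, \ldots$ is an infinite sequence of $Q$-labelled graphic sequences such that, for every $i$, at most $N$ of the degree entries of $D_i$ exceed $N$, then there exist indices $i < j$ such that $D_i \leq D_j$.
   Context: All graphs are finite and simple (no loops, no multiple edges). An integer sequence $(d_1,\ldots,d_n)$ with $d_1 \geq \cdots \geq d_n \geq 1$ is graphic if there exists a graph whose vertex degrees are $d_1,\ldots,d_n$. A quasi-order is a pair $(Q,\leq)$ where $\leq$ is a reflexive and transitive relation on the set $Q$. It is a well-quasi-order (WQO) if for every infinite sequence $q_1,q_2,\ldots$ in $Q$ there exist $i<j$ with $q_i \leq q_j$. Let $(Q,\leq)$ be a WQO. A $Q$-labelled graphic sequence is a sequence $((d_1,q_1),\ldots,(d_n,q_n))$ where $(d_1,\ldots,d_n)$ is a graphic sequence and $q_i \in Q$ for $1 \leq i \leq n$; its degree entries are $d_1,\ldots,d_n$. A $Q$-labelled graph is a pair $(G,f_G)$ where $G$ is a graph and $f_G : V(G) \to Q$ is a function. A $Q$-labelled graph $G$ is an induced subgraph of a $Q$-labelled graph $H$ if there exists an injection $\phi : V(G) \to V(H)$ such that (i) for all $x,y \in V(G)$, $xy \in E(G)$ if and only if $\phi(x)\phi(y) \in E(H)$, and (ii) $f_G(x) \leq f_H(\phi(x))$ for all $x \in V(G)$. A $Q$-labelled graph $(G,f)$ realizes $((d_1,q_1),\ldots,(d_n,q_n))$ if $V(G) = \{x_1,\ldots,x_n\}$ (with the $x_i$ distinct),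 where $x_i$ has degree $d_i$ and $f(x_i) = q_i$ for $1 \leq i \leq n$. For $Q$-labelled graphic sequences $D_1, D_2$, write $D_1 \leq D_2$ if there exist $Q$-labelled graphs $G_1$ and $G_2$ such that $G_1$ realizes $D_1$, $G_2$ realizes $D_2$, and $G_1$ is an induced subgraph of $G_2$ (as $Q$-labelled graphs). *)

theory Defs
  imports "Graph_Theory.Pair_Digraph"
begin

text \<open>
  Finite simple graphs are the graphs of the locale \<open>pair_graph\<close>: a finite vertex set
  together with a symmetric irreflexive set of ordered pairs of vertices, so an edge $xy$ is
  the pair of arcs $(x, y)$, $(y, x)$.  The degree of a vertex is therefore its out-degree.
\<close>

abbreviation degree :: "'v pair_pre_digraph \<Rightarrow> 'v \<Rightarrow> nat" where
  "degree G v \<equiv> out_degree (with_proj G) v"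

lemma (in pair_graph) degree_eq_card_neighbours:
  "degree G v = card {w. (v, w) \<in> parcs G}"
proof -
  have "out_arcs (with_proj G) v = Pair v ` {w. (v, w) \<in> parcs G}"
    by (auto simp: out_arcs_def)
  then show ?thesis
    by (simp add: out_degree_def card_image inj_on_def)
qed

definition quasi_order_on :: "'q set \<Rightarrow> ('q \<Rightarrow> 'q \<Rightarrow> bool) \<Rightarrow> bool" where
  "quasi_order_on Q le \<longleftrightarrow> reflp_on Q le \<and> transp_on Q le"

definition wqo_on :: "'q set \<Rightarrow> ('q \<Rightarrow> 'q \<Rightarrow> bool) \<Rightarrow> bool" where
  "wqo_on Q le \<longleftrightarrow> quasi_order_on Q le \<and>
     (\<forall>q :: nat \<Rightarrow> 'q. (\<forall>i. q i \<in> Q) \<longrightarrow> (\<exists>i j. i < j \<and> le (q i) (q j)))"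

text \<open>
  Since graphs are finite, nothing is lost by letting the existentially quantified graphs
  in \<open>graphic\<close> and \<open>labelled_seq_le\<close> have natural numbers as vertices.
\<close>

definition graphic :: "nat list \<Rightarrow> bool" where
  "graphic ds \<longleftrightarrow> sorted_wrt (\<ge>) ds \<and> (\<forall>d \<in> set ds. d \<ge> 1) \<and>
     (\<exists>(G :: nat pair_pre_digraph) xs. pair_graph G \<and>
        distinct xs \<and> set xs = pverts G \<and> map (degree G) xs = ds)"

definition labelled_graphic_seq :: "'q set \<Rightarrow> (nat \<times> 'q) list \<Rightarrow> bool" where
  "labelled_graphic_seq Q D \<longleftrightarrow> graphic (map fst D) \<and> set (map snd D) \<subseteq> Q"

text \<open>Labellings are total functions; their values outside the vertex set are irrelevant.\<close>

definition labelled_graph :: "'q set \<Rightarrow> 'v pair_pre_digraph \<Rightarrow> ('v \<Rightarrow> 'q) \<Rightarrow> bool" where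
  "labelled_graph Q G f \<longleftrightarrow> pair_graph G \<and> f ` pverts G \<subseteq> Q"

definition labelled_induced_subgraph ::
  "('q \<Rightarrow> 'q \<Rightarrow> bool) \<Rightarrow> 'v pair_pre_digraph \<Rightarrow> ('v \<Rightarrow> 'q) \<Rightarrow>
    'w pair_pre_digraph \<Rightarrow> ('w \<Rightarrow> 'q) \<Rightarrow> bool" where
  "labelled_induced_subgraph le G f H g \<longleftrightarrow>
     (\<exists>\<phi>. inj_on \<phi> (pverts G) \<and> \<phi> ` pverts G \<subseteq> pverts H \<and>
        (\<forall>x \<in> pverts G. \<forall>y \<in> pverts G. (x, y) \<in> parcs G \<longleftrightarrow> (\<phi> x, \<phi> y) \<in> parcs H) \<and>
        (\<forall>x \<in> pverts G. le (f x) (g (\<phi> x))))"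

definition realizes :: "'v pair_pre_digraph \<Rightarrow> ('v \<Rightarrow> 'q) \<Rightarrow> (nat \<times> 'q) list \<Rightarrow> bool" where
  "realizes G f D \<longleftrightarrow>
     (\<exists>xs. distinct xs \<and> set xs = pverts G \<and> map (\<lambda>x. (degree G x, f x)) xs = D)"

definition labelled_seq_le ::
  "'q set \<Rightarrow> ('q \<Rightarrow> 'q \<Rightarrow> bool) \<Rightarrow> (nat \<times> 'q) list \<Rightarrow> (nat \<times> 'q) list \<Rightarrow> bool" where
  "labelled_seq_le Q le D1 D2 \<longleftrightarrow>
     (\<exists>(G1 :: nat pair_pre_digraph) f1 (G2 :: nat pair_pre_digraph) f2.
        labelled_graph Q G1 f1 \<and> labelled_graph Q G2 f2 \<and>
        realizes G1 f1 D1 \<and> realizes G2 f2 D2 \<and>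
        labelled_induced_subgraph le G1 f1 G2 f2)"

end

theory Submission
  imports Defs "HOL-Library.Sublist" "HOL-Library.Infinite_Set" "HOL-Library.FuncSet"
begin

text \<open>
  Call the vertices in the first \<open>N\<close> positions \<^emph>\<open>hubs\<close>; as the degrees are sorted, every other
  vertex has degree at most \<open>N\<close>.  Fix a realization of every \<open>D i\<close> and write it as a word whose
  letter for a vertex records its position if it is a hub, its set of neighbouring hubs, its
  number of non-hub neighbours, and its label.  By Higman's lemma and the pigeonhole principle
  there are \<open>i < j\<close> such that the word of \<open>D i\<close> embeds into that of \<open>D j\<close> and, for each \<open>a \<le> N\<close>,
  the numbers of non-hubs with \<open>a\<close> non-hub neighbours agree modulo \<open>a + 1\<close>.  Now rewire the
  realization of \<open>D j\<close>: on the image of the embedding copy the non-hub edges of \<open>D i\<close>, and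
  arrange the remaining non-hubs that need \<open>a\<close> non-hub neighbours into disjoint copies of the
  complete graph on \<open>a + 1\<close> vertices.  All degrees are preserved.
\<close>

section \<open>Higman's lemma\<close>

lemma wqo_onE:
  fixes q :: "nat \<Rightarrow> 'a"
  assumes "wqo_on A le" and "\<And>i. q i \<in> A"
  obtains i j where "i < j" and "le (q i) (q j)"
  using assms unfolding wqo_on_def by blast

text \<open>Positions with no larger-or-equal term after them form a finite set \<open>T\<close>,
  since infinitely many of them would enumerate a sequence contradicting \<open>wqo\<close>. Beyond
  \<open>T\<close> every term can be followed by one above it; iterating this choice and using
  transitivity gives the subsequence.\<close>

lemma wqo_on_ascending_subseq:
  fixes q :: "nat \<Rightarrow> 'a"
  assumes wqo: "wqo_on A le" and q: "\<And>i. q i \<in> A"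
  shows "\<exists>\<phi> :: nat \<Rightarrow> nat. strict_mono \<phi> \<and> (\<forall>i j. i < j \<longrightarrow> le (q (\<phi> i)) (q (\<phi> j)))"
proof -
  define T where "T = {i. \<forall>j>i. \<not> le (q i) (q j)}"
  have "finite T"
  proof (rule ccontr)
    assume "infinite T"
    then obtain r :: "nat \<Rightarrow> nat" where r: "strict_mono r" "\<And>n. r n \<in> T"
      using infinite_enumerate by blast
    obtain i j where "i < j" "le (q (r i)) (q (r j))"
      using wqo_onE[OF wqo, of "\<lambda>i. q (r i)"] q by blast
    moreover have "r i < r j"
      using \<open>i < j\<close> r(1) by (simp add: strict_mono_less)
    ultimately show False
      using r(2)[of i] unfolding T_def by blast
  qed
  then obtain b where b: "\<And>i. i \<ge> b \<Longrightarrow> i \<notin> T"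
    using finite_nat_bounded[of T] by (metis in_mono lessThan_iff not_le)
  have "\<exists>\<phi>. \<forall>n. b \<le> \<phi> n \<and> \<phi> n < \<phi> (Suc n) \<and> le (q (\<phi> n)) (q (\<phi> (Suc n)))"
  proof (rule dependent_nat_choice)
    show "\<exists>x. b \<le> x" by blast
    fix x :: nat assume "b \<le> x"
    then obtain y where "x < y" "le (q x) (q y)"
      using b unfolding T_def by blast
    then show "\<exists>y. b \<le> y \<and> x < y \<and> le (q x) (q y)"
      using \<open>b \<le> x\<close> by (intro exI[of _ y]) simp
  qed
  then obtain \<phi> where \<phi>: "\<And>n. \<phi> n < \<phi> (Suc n)" "\<And>n. le (q (\<phi> n)) (q (\<phi> (Suc n)))"
    by blast
  have tr: "transp_on A le"
    using wqo by (simp add: wqo_on_def quasi_order_on_def)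
  have "le (q (\<phi> i)) (q (\<phi> j))" if "i < j" for i j
    using that
  proof (induction rule: less_Suc_induct)
    case (2 i j k)
    then show ?case
      using tr q by (blast dest: transp_onD)
  qed (rule \<phi>(2))
  with \<phi>(1) show ?thesis
    by (auto simp: strict_mono_Suc_iff)
qed

text \<open>By pigeonhole one first component occurs infinitely often, and the second components
  along that subsequence are governed by \<open>le\<close>. This serves both for the letters
  (colour, label) and for the pairs (residues, word).\<close>

lemma wqo_on_finite_Times:
  assumes "finite C" and wqo: "wqo_on A le"
  shows "wqo_on (C \<times> A) (\<lambda>x y. fst x = fst y \<and> le (snd x) (snd y))"
proof -
  have rt: "reflp_on A le" "transp_on A le"
    using wqo by (auto simp: wqo_on_def quasi_order_on_def)
  have "\<exists>i j. i < j \<and> fst (q i) = fst (q j) \<and> le (snd (q i)) (snd (q j))"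
    if q: "\<forall>i. q i \<in> C \<times> A" for q :: "nat \<Rightarrow> _"
  proof -
    have "finite (range (fst \<circ> q))"
      using q by (intro finite_subset[OF _ \<open>finite C\<close>]) (auto simp: mem_Times_iff)
    then obtain k where "infinite {i. fst (q i) = fst (q k)}"
      using pigeonhole_infinite[of UNIV "fst \<circ> q"] by auto
    then obtain r :: "nat \<Rightarrow> nat" where r: "strict_mono r" "\<And>n. fst (q (r n)) = fst (q k)"
      using infinite_enumerate by blast
    obtain i j where "i < j" "le (snd (q (r i))) (snd (q (r j)))"
      using wqo_onE[OF wqo, of "\<lambda>i. snd (q (r i))"] q by (auto simp: mem_Times_iff)
    then show ?thesis
      using r by (metis strict_mono_less)
  qed
  then show ?thesis
    using rt unfolding wqo_on_def quasi_order_on_def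
    by (auto intro!: reflp_onI transp_onI dest: reflp_onD transp_onD)
qed

text \<open>The selection step of Nash-Williams: entries are fixed one after the other, each as
  light as possible among bad sequences continuing the entries already fixed. The diagonal of the
  successive choices is \<open>m\<close>.\<close>

lemma minimal_bad_sequence:
  fixes A :: "'a set" and R :: "'a \<Rightarrow> 'a \<Rightarrow> bool" and weight :: "'a \<Rightarrow> nat"
  defines "bad \<equiv> \<lambda>s :: nat \<Rightarrow> 'a. (\<forall>i. s i \<in> A) \<and> (\<forall>i j. i < j \<longrightarrow> \<not> R (s i) (s j))"
  assumes "bad s0"
  obtains m where "bad m"
    and "\<And>t n. bad t \<Longrightarrow> \<forall>k<n. t k = m k \<Longrightarrow> weight (m n) \<le> weight (t n)"
proof -
  define min_at where "min_at \<equiv> \<lambda>n s. bad s \<and>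
    (\<forall>t. bad t \<longrightarrow> (\<forall>k<n. t k = s k) \<longrightarrow> weight (s n) \<le> weight (t n))"
  have ex: "\<exists>t. min_at n t \<and> (\<forall>k<n. t k = s k)" if "bad s" for s n
  proof -
    obtain t where "bad t \<and> (\<forall>k<n. t k = s k)"
      and "\<forall>u. bad u \<and> (\<forall>k<n. u k = s k) \<longrightarrow> weight (t n) \<le> weight (u n)"
      using ex_has_least_nat[of "\<lambda>t. bad t \<and> (\<forall>k<n. t k = s k)" s "\<lambda>t. weight (t n)"] \<open>bad s\<close>
      by metis
    then show ?thesis
      unfolding min_at_def by (intro exI[of _ t]) auto
  qed
  \<comment> \<open>Stage \<open>Suc n\<close> keeps the entries up to and including
    \<open>n\<close>, so entry \<open>n\<close> never changes after stage \<open>n\<close>.\<close>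
  have "\<exists>S. \<forall>n. min_at n (S n) \<and> (\<forall>k<Suc n. S (Suc n) k = S n k)"
  proof (rule dependent_nat_choice)
    show "\<exists>x. min_at 0 x"
      using ex[OF \<open>bad s0\<close>] by blast
    fix s n assume "min_at n s"
    then have "bad s" by (simp add: min_at_def)
    from ex[OF this, of "Suc n"]
    show "\<exists>t. min_at (Suc n) t \<and> (\<forall>k<Suc n. t k = s k)" .
  qed
  then obtain S where S: "\<And>n. min_at n (S n)" "\<And>n k. k < Suc n \<Longrightarrow> S (Suc n) k = S n k"
    by blast
  define m where "m = (\<lambda>n. S n n)"
  have agree: "S n k = m k" if "k \<le> n" for n k
    using that
  proof (induction n rule: dec_induct)
    case (step n)
    then show ?case using S(2)[of k n] by simp
  qed (simp add: m_def)
  have badS: "bad (S n)" for n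
    using S(1) by (simp add: min_at_def)
  \<comment> \<open>Badness is a condition on pairs, and a pair \<open>i < j\<close> of entries of
    \<open>m\<close> already occurs in the bad sequence \<open>S j\<close>.\<close>
  have "bad m"
    unfolding bad_def
  proof (intro conjI allI impI)
    show "m i \<in> A" for i
      using badS[of i] unfolding bad_def m_def by blast
    show "\<not> R (m i) (m j)" if "i < j" for i j
      using badS[of j] agree[of i j] agree[of j j] that unfolding bad_def
      by (metis less_imp_le order_refl)
  qed
  moreover have "weight (m n) \<le> weight (t n)" if "bad t" "\<forall>k<n. t k = m k" for t n
    using S(1)[of n] that agree unfolding min_at_def by (metis less_imp_le order_refl)
  ultimately show thesis
    by (rule that)
qed

text \<open>Higman's lemma by a minimal bad sequence, with length as the weight: deleting heads
  along a subsequence with ascending heads would give a bad sequence that is smaller at its first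
  changed entry.\<close>

theorem wqo_on_list_emb:
  assumes wqo: "wqo_on A P"
  shows "wqo_on (lists A) (list_emb P)"
proof -
  have rt: "reflp_on A P" "transp_on A P"
    using wqo by (auto simp: wqo_on_def quasi_order_on_def)
  have "reflp_on (lists A) (list_emb P)"
    using rt(1) by (auto intro!: reflp_onI list_emb_refl dest: reflp_onD)
  moreover have "transp_on (lists A) (list_emb P)"
  proof (rule transp_onI)
    fix x y z assume xyz: "x \<in> lists A" "y \<in> lists A" "z \<in> lists A"
    assume "list_emb P x y" "list_emb P y z"
    then show "list_emb P x z"
      by (rule list_emb_trans[rotated 1]) (use rt(2) xyz in \<open>auto dest: transp_onD\<close>)
  qed
  moreover have "\<exists>i j. i < j \<and> list_emb P (s i) (s j)" if s: "\<forall>i. s i \<in> lists A"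
    for s :: "nat \<Rightarrow> 'a list"
  proof (rule ccontr)
    assume "\<not> ?thesis"
    then have "(\<forall>i. s i \<in> lists A) \<and> (\<forall>i j. i < j \<longrightarrow> \<not> list_emb P (s i) (s j))"
      using s by blast
    then obtain m :: "nat \<Rightarrow> 'a list" where m: "\<And>i. m i \<in> lists A" "\<And>i j. i < j \<Longrightarrow> \<not> list_emb P (m i) (m j)"
      and minimal: "\<And>t n. \<lbrakk>\<forall>i. t i \<in> lists A; \<forall>i j. i < j \<longrightarrow> \<not> list_emb P (t i) (t j);
        \<forall>k<n. t k = m k\<rbrakk> \<Longrightarrow> length (m n) \<le> length (t n)"
      by (rule minimal_bad_sequence[where weight = length]) blast
    have ne: "m i \<noteq> []" for i
      using m(2)[of i "Suc i"] by auto
    have hd: "hd (m i) \<in> A" for i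
      using m(1)[of i] ne[of i] by (cases "m i") auto
    have tl: "tl (m i) \<in> lists A" for i
      using m(1)[of i] ne[of i] by (cases "m i") auto
    obtain \<phi> :: "nat \<Rightarrow> nat" where \<phi>: "strict_mono \<phi>"
      "\<And>i j. i < j \<Longrightarrow> P (hd (m (\<phi> i))) (hd (m (\<phi> j)))"
      using wqo_on_ascending_subseq[OF wqo, of "\<lambda>i. hd (m i)"] hd by blast
    define b where "b = \<phi> 0"
    \<comment> \<open>The sequence follows \<open>m\<close> before position \<open>b\<close> and
      then runs through the tails of \<open>m (\<phi> 0)\<close>, \<open>m (\<phi> 1)\<close>, and
      so on. An embedding between two of its entries would yield one in \<open>m\<close>: a tail
      embeds into its full word, and comparable heads can be put back. At \<open>b\<close> it is
      shorter than \<open>m\<close>.\<close>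
    define t where "t = (\<lambda>k. if k < b then m k else tl (m (\<phi> (k - b))))"
    have b_le: "b \<le> \<phi> k" for k
      using \<phi>(1) by (simp add: b_def strict_mono_less_eq)
    have "\<not> list_emb P (t i) (t j)" if "i < j" for i j
    proof
      assume emb: "list_emb P (t i) (t j)"
      show False
      proof (cases "j < b")
        case True
        then show False
          using emb \<open>i < j\<close> m(2)[of i j] by (simp add: t_def)
      next
        case j: False
        let ?j = "\<phi> (j - b)"
        have mj: "m ?j = hd (m ?j) # tl (m ?j)"
          using ne by simp
        show False
        proof (cases "i < b")
          case True
          then have "list_emb P (m i) (tl (m ?j))"
            using emb j by (simp add: t_def)
          then have "list_emb P (m i) (m ?j)"
            by (subst mj) (rule list_emb_Cons)
          moreover have "i < ?j"
            using True b_le[of "j - b"] by simp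
          ultimately show False
            using m(2) by blast
        next
          case i: False
          let ?i = "\<phi> (i - b)"
          have lt: "i - b < j - b"
            using i \<open>i < j\<close> by simp
          have mi: "m ?i = hd (m ?i) # tl (m ?i)"
            using ne by simp
          have "list_emb P (tl (m ?i)) (tl (m ?j))"
            using emb i j by (simp add: t_def)
          then have "list_emb P (m ?i) (m ?j)"
            by (subst mi, subst mj) (intro list_emb_Cons2 \<phi>(2) lt)
          moreover have "?i < ?j"
            using lt \<phi>(1) by (simp add: strict_mono_less)
          ultimately show False
            using m(2) by blast
        qed
      qed
    qed
    moreover have "\<forall>i. t i \<in> lists A"
      using m(1) tl unfolding t_def by metis
    ultimately have "length (m b) \<le> length (t b)"
      by (intro minimal) (auto simp: t_def)
    then show False
      using ne[of "\<phi> 0"] by (cases "m (\<phi> 0)") (auto simp: t_def b_def)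
  qed
  ultimately show ?thesis
    unfolding wqo_on_def quasi_order_on_def by blast
qed

text \<open>A skipped letter of \<open>ys\<close> shifts all target positions by one; a matched pair
  of letters sends 0 to 0 and shifts the map for the tails.\<close>

lemma list_emb_index_map:
  assumes "list_emb P xs ys"
  shows "\<exists>\<phi>. inj_on \<phi> {..<length xs} \<and> \<phi> ` {..<length xs} \<subseteq> {..<length ys} \<and>
    (\<forall>i<length xs. P (xs ! i) (ys ! \<phi> i))"
  using assms
proof induction
  case (list_emb_Cons xs ys y)
  then obtain \<phi> where "inj_on \<phi> {..<length xs}" "\<phi> ` {..<length xs} \<subseteq> {..<length ys}"
    "\<forall>i<length xs. P (xs ! i) (ys ! \<phi> i)"
    by blast
  then show ?case
    by (intro exI[of _ "\<lambda>i. Suc (\<phi> i)"]) (auto simp: inj_on_def)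
next
  case (list_emb_Cons2 x y xs ys)
  then obtain \<phi> where "inj_on \<phi> {..<length xs}" "\<phi> ` {..<length xs} \<subseteq> {..<length ys}"
    "\<forall>i<length xs. P (xs ! i) (ys ! \<phi> i)"
    by blast
  then show ?case
    using list_emb_Cons2.hyps(1)
    by (intro exI[of _ "case_nat 0 (\<lambda>i. Suc (\<phi> i))"])
      (auto simp: inj_on_def image_subset_iff less_Suc_eq_0_disj split: nat.splits)
qed auto

section \<open>Graphs as symmetric irreflexive relations\<close>

text \<open>Keeping the edge relation apart from the vertex set lets edge sets on one vertex set be
  glued by unions.\<close>

definition graph_on :: "'a set \<Rightarrow> 'a rel \<Rightarrow> bool" where
  "graph_on V E \<longleftrightarrow> E \<subseteq> V \<times> V \<and> sym E \<and> irrefl E"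

lemma graph_on_Image_subset: "graph_on V E \<Longrightarrow> E `` X \<subseteq> V"
  by (auto simp: graph_on_def)

lemma pair_graph_iff_graph_on:
  "pair_graph G \<longleftrightarrow> finite (pverts G) \<and> graph_on (pverts G) (parcs G)"
proof
  assume "pair_graph G"
  then interpret pair_graph G .
  show "finite (pverts G) \<and> graph_on (pverts G) (parcs G)"
    using pair_finite_verts pair_sym_arcs in_arcsD1 in_arcsD2 pair_no_loops
    by (force simp: graph_on_def symmetric_def irrefl_def)
next
  assume *: "finite (pverts G) \<and> graph_on (pverts G) (parcs G)"
  then have "finite (parcs G)"
    by (auto simp: graph_on_def intro: finite_subset)
  then show "pair_graph G"
    using * by unfold_locales (auto simp: graph_on_def symmetric_def irrefl_def)
qed

lemma pair_graph_degree_eq: "pair_graph G \<Longrightarrow> degree G v = card (parcs G `` {v})"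
  by (simp add: pair_graph.degree_eq_card_neighbours Image_singleton)

text \<open>Vertices are renamed to their positions in the sequence, so that an embedding of words
  is directly a map of vertices.\<close>

lemma graphic_realization_on_positions:
  assumes "graphic ds"
  shows "\<exists>E. graph_on {..<length ds} E \<and> (\<forall>v<length ds. card (E `` {v}) = ds ! v)"
proof -
  obtain G :: "nat pair_pre_digraph" and xs where G: "pair_graph G"
    and xs: "distinct xs" "set xs = pverts G" "map (degree G) xs = ds"
    using assms unfolding graphic_def by blast
  have len: "length xs = length ds"
    using xs(3) by auto
  have bij: "bij_betw ((!) xs) {..<length ds} (pverts G)"
    using bij_betw_nth[OF xs(1)] xs(2) len by simp
  have graph: "graph_on (pverts G) (parcs G)"
    using G by (simp add: pair_graph_iff_graph_on)
  define E where "E = {(u, v). u < length ds \<and> v < length ds \<and> (xs ! u, xs ! v) \<in> parcs G}"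
  have "graph_on {..<length ds} E"
    using graph by (auto simp: graph_on_def E_def sym_def irrefl_def)
  moreover have "card (E `` {v}) = ds ! v" if v: "v < length ds" for v
  proof -
    have "(!) xs ` (E `` {v}) = parcs G `` {xs ! v}"
    proof (intro equalityI subsetI)
      fix y assume y: "y \<in> parcs G `` {xs ! v}"
      then have "y \<in> (!) xs ` {..<length ds}"
        using graph_on_Image_subset[OF graph] bij by (auto simp: bij_betw_def)
      then show "y \<in> (!) xs ` (E `` {v})"
        using y v by (auto simp: E_def)
    qed (auto simp: E_def)
    moreover have "inj_on ((!) xs) (E `` {v})"
      using bij by (rule inj_on_subset[OF bij_betw_imp_inj_on]) (auto simp: E_def)
    ultimately have "card (E `` {v}) = card (parcs G `` {xs ! v})"
      by (metis card_image)
    also have "\<dots> = ds ! v"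
      using xs(3) v len pair_graph_degree_eq[OF G, of "xs ! v"] by (metis nth_map)
    finally show ?thesis .
  qed
  ultimately show ?thesis
    by blast
qed

text \<open>The way back from edge relations on positions to labelled graphs and
  \<open>realizes\<close>.\<close>

lemma realizes_on_positions:
  assumes "set (map snd D) \<subseteq> Q" and E: "graph_on {..<length D} E"
    and deg: "\<And>v. v < length D \<Longrightarrow> card (E `` {v}) = fst (D ! v)"
  defines "G \<equiv> \<lparr>pverts = {..<length D}, parcs = E\<rparr>" and "f \<equiv> \<lambda>v. snd (D ! v)"
  shows "labelled_graph Q G f" and "realizes G f D"
proof -
  have G: "pair_graph G"
    using E by (simp add: pair_graph_iff_graph_on G_def)
  show "labelled_graph Q G f"
    using G assms(1) by (auto simp: labelled_graph_def G_def f_def)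
  have "degree G v = fst (D ! v)" if "v < length D" for v
    using pair_graph_degree_eq[OF G] deg[OF that] by (simp add: G_def)
  then show "realizes G f D"
    unfolding realizes_def G_def f_def
    by (intro exI[of _ "[0..<length D]"]) (auto simp: atLeast0LessThan intro!: nth_equalityI)
qed

section \<open>Rewiring\<close>

text \<open>The vertices that demand degree \<open>a\<close> can be cut into blocks of size
  \<open>a + 1\<close>; making each block complete gives every vertex its demand.\<close>

lemma disjoint_cliques:
  fixes d :: "'a \<Rightarrow> nat"
  assumes R: "finite R" and dvd: "\<And>a. Suc a dvd card {v \<in> R. d v = a}"
  shows "\<exists>F. graph_on R F \<and> (\<forall>v\<in>R. card (F `` {v}) = d v)"
proof -
  define S where "S = (\<lambda>a. {v \<in> R. d v = a})"
  have "\<forall>a. \<exists>h. bij_betw h (S a) {..<card (S a)}"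
    using R ex_bij_betw_finite_nat[of "S _"] by (simp add: S_def atLeast0LessThan)
  then obtain h where h: "\<And>a. bij_betw (h a) (S a) {..<card (S a)}"
    by metis
  \<comment> \<open>\<open>h a\<close> numbers the vertices of demand \<open>a\<close> from 0, and
    consecutive runs of \<open>Suc a\<close> numbers form the blocks.\<close>
  define block where "block = (\<lambda>v. h (d v) v div Suc (d v))"
  define F where "F = {(u, v). u \<in> R \<and> v \<in> R \<and> d u = d v \<and> block u = block v \<and> u \<noteq> v}"
  have "graph_on R F"
    by (auto simp: graph_on_def F_def sym_def irrefl_def)
  moreover have "card (F `` {v}) = d v" if v: "v \<in> R" for v
  proof -
    define a where "a = d v"
    define c where "c = block v"
    define B where "B = {u \<in> S a. h a u div Suc a = c}"
    obtain k where k: "card (S a) = Suc a * k"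
      using dvd[of a] unfolding S_def by (auto simp: dvd_def)
    have "v \<in> S a"
      using v by (simp add: S_def a_def)
    then have "h a v < Suc a * k"
      using h[of a] k by (auto simp: bij_betw_def)
    then have "c < k"
      by (simp add: c_def block_def a_def less_mult_imp_div_less mult.commute del: mult_Suc)
    \<comment> \<open>Because \<open>c < k\<close>, the whole interval lies below
      \<open>card (S a)\<close>: no block is incomplete.\<close>
    have "h a ` B = {Suc a * c..<Suc a * Suc c}"
    proof (intro equalityI subsetI)
      fix x assume "x \<in> h a ` B"
      then have "x div Suc a = c"
        by (auto simp: B_def)
      then show "x \<in> {Suc a * c..<Suc a * Suc c}"
        by (metis atLeastLessThan_iff dividend_less_times_div mult_Suc_right
            times_div_less_eq_dividend zero_less_Suc add.commute)
    next
      fix x assume x: "x \<in> {Suc a * c..<Suc a * Suc c}"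
      then have "x div Suc a = c"
        by (intro div_nat_eqI) (auto simp: algebra_simps)
      moreover have "Suc a * Suc c \<le> Suc a * k"
        using \<open>c < k\<close> by (intro mult_le_mono) auto
      then have "x < card (S a)"
        using x k by simp
      then have "x \<in> h a ` S a"
        using h[of a] by (simp add: bij_betw_def)
      ultimately show "x \<in> h a ` B"
        by (auto simp: B_def)
    qed
    moreover have "inj_on (h a) B"
      using h[of a] by (rule inj_on_subset[OF bij_betw_imp_inj_on]) (auto simp: B_def)
    ultimately have "card B = Suc a"
      using card_image by fastforce
    moreover have "F `` {v} = B - {v}"
      using v by (auto simp: F_def B_def S_def block_def c_def a_def)
    moreover have "v \<in> B"
      using \<open>v \<in> S a\<close> by (simp add: B_def c_def block_def a_def)
    ultimately show ?thesis
      by (simp add: a_def)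
  qed
  ultimately show ?thesis
    by blast
qed

text \<open>Edges of \<open>E2\<close> meeting \<open>H\<close> stay; those outside \<open>H\<close>
  are replaced by the copy \<open>K\<close> of the edges of \<open>E1\<close> outside
  \<open>H\<close>, together with \<open>F\<close> off the image. Vertices in \<open>H\<close> keep
  their neighbours, and the others keep their neighbours in \<open>H\<close> and the number of
  neighbours outside, by \<open>outer\<close> or \<open>degF\<close>.\<close>

lemma rewire_along_embedding:
  fixes H :: "'a set"
  assumes E1: "graph_on V1 E1" and E2: "graph_on V2 E2" and fin: "finite V1" "finite V2"
    and inj: "inj_on \<phi> V1" and into: "\<phi> ` V1 \<subseteq> V2"
    and hub: "\<And>v. v \<in> V1 \<Longrightarrow> v \<in> H \<Longrightarrow> \<phi> v = v"
    and nonhub: "\<And>v. v \<in> V1 \<Longrightarrow> v \<notin> H \<Longrightarrow> \<phi> v \<notin> H"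
    and att: "\<And>v. v \<in> V1 \<Longrightarrow> E1 `` {v} \<inter> H = E2 `` {\<phi> v} \<inter> H"
    and outer: "\<And>v. v \<in> V1 \<Longrightarrow> v \<notin> H \<Longrightarrow> card (E1 `` {v} - H) = card (E2 `` {\<phi> v} - H)"
    and F: "graph_on (V2 - H - \<phi> ` V1) F"
    and degF: "\<And>v. v \<in> V2 - H - \<phi> ` V1 \<Longrightarrow> card (F `` {v}) = card (E2 `` {v} - H)"
  shows "\<exists>E. graph_on V2 E \<and> (\<forall>v\<in>V2. card (E `` {v}) = card (E2 `` {v})) \<and>
    (\<forall>u\<in>V1. \<forall>v\<in>V1. (u, v) \<in> E1 \<longleftrightarrow> (\<phi> u, \<phi> v) \<in> E)"
proof -
  define K where "K = {(\<phi> u, \<phi> v) | u v. (u, v) \<in> E1 \<and> u \<notin> H \<and> v \<notin> H}"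
  define E where "E = {(u, v) \<in> E2. u \<in> H \<or> v \<in> H} \<union> K \<union> F"
  have V1: "u \<in> V1" "v \<in> V1" if "(u, v) \<in> E1" for u v
    using E1 that by (auto simp: graph_on_def)
  have V2: "u \<in> V2" "v \<in> V2" if "(u, v) \<in> E2" for u v
    using E2 that by (auto simp: graph_on_def)
  have K: "u \<in> \<phi> ` V1 - H" "v \<in> \<phi> ` V1 - H" if "(u, v) \<in> K" for u v
    using that V1 nonhub by (auto simp: K_def)
  have Fv: "u \<in> V2 - H - \<phi> ` V1" "v \<in> V2 - H - \<phi> ` V1" if "(u, v) \<in> F" for u v
    using F that by (auto simp: graph_on_def)
  have "sym K"
    using E1 unfolding K_def sym_def graph_on_def by blast
  have "irrefl K"
    using E1 V1 inj_onD[OF inj] by (fastforce simp: K_def irrefl_def graph_on_def)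
  have "graph_on V2 E"
    unfolding graph_on_def
  proof (intro conjI)
    show "E \<subseteq> V2 \<times> V2"
      using into by (auto simp: E_def dest: V2 K Fv)
    show "sym E"
      using \<open>sym K\<close> E2 F by (auto simp: E_def graph_on_def sym_def)
    show "irrefl E"
      using \<open>irrefl K\<close> E2 F by (auto simp: E_def graph_on_def irrefl_def)
  qed
  moreover have "card (E `` {v}) = card (E2 `` {v})" if v: "v \<in> V2" for v
  proof (cases "v \<in> H")
    case True
    then have "E `` {v} = E2 `` {v}"
      by (auto simp: E_def dest: K Fv)
    then show ?thesis by simp
  next
    case False
    have out: "card (E `` {v} - H) = card (E2 `` {v} - H)"
    proof (cases "v \<in> \<phi> ` V1")
      case True
      then obtain u where u: "u \<in> V1" "v = \<phi> u" by blast
      have "u \<notin> H"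
        using hub[of u] u False by auto
      have "E `` {v} - H = \<phi> ` (E1 `` {u} - H)"
      proof (intro equalityI subsetI)
        fix w assume w: "w \<in> E `` {v} - H"
        then have "(v, w) \<in> K"
          using False True Fv(1)[of v w] by (auto simp: E_def)
        then obtain x y where xy: "v = \<phi> x" "w = \<phi> y" "(x, y) \<in> E1" "y \<notin> H"
          unfolding K_def by auto
        then have "x = u"
          using u V1 inj_onD[OF inj] by metis
        then show "w \<in> \<phi> ` (E1 `` {u} - H)"
          using xy by auto
      next
        fix w assume "w \<in> \<phi> ` (E1 `` {u} - H)"
        then obtain y where y: "w = \<phi> y" "(u, y) \<in> E1" "y \<notin> H" by auto
        then have "(v, w) \<in> K"
          using u \<open>u \<notin> H\<close> by (auto simp: K_def)
        then show "w \<in> E `` {v} - H"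
          using K by (auto simp: E_def)
      qed
      moreover have "inj_on \<phi> (E1 `` {u} - H)"
        by (rule inj_on_subset[OF inj]) (auto dest: V1)
      ultimately show ?thesis
        using outer[OF u(1) \<open>u \<notin> H\<close>] u(2) by (simp add: card_image)
    next
      case v': False
      then have "E `` {v} - H = F `` {v}"
        using False by (auto simp: E_def dest: K Fv)
      then show ?thesis
        using degF[of v] v v' False by simp
    qed
    have "E `` {v} \<inter> H = E2 `` {v} \<inter> H"
      by (auto simp: E_def dest: K Fv)
    moreover have "finite (E `` {v})" "finite (E2 `` {v})"
      using graph_on_Image_subset[OF \<open>graph_on V2 E\<close>] graph_on_Image_subset[OF E2] fin(2)
      by (meson finite_subset)+
    ultimately show ?thesis
      using out by (metis card_Int_Diff)
  qed
  moreover have "(u, v) \<in> E1 \<longleftrightarrow> (\<phi> u, \<phi> v) \<in> E" if uv: "u \<in> V1" "v \<in> V1" for u v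
  proof (cases "u \<in> H \<or> v \<in> H")
    case True
    \<comment> \<open>A vertex \<open>y\<close> in \<open>H\<close> is fixed by
      \<open>\<phi>\<close>, so \<open>att\<close> at \<open>x\<close> decides the pair. If only the
      first endpoint is in \<open>H\<close>, symmetry exchanges the roles.\<close>
    have att': "(x, y) \<in> E1 \<longleftrightarrow> (\<phi> x, \<phi> y) \<in> E2" if "x \<in> V1" "y \<in> V1" "y \<in> H" for x y
      using att[OF that(1)] hub[OF that(2,3)] that(3) by auto
    have sym: "(x, y) \<in> E1 \<longleftrightarrow> (y, x) \<in> E1" "(x, y) \<in> E2 \<longleftrightarrow> (y, x) \<in> E2" for x y
      using E1 E2 by (auto simp: graph_on_def dest: symD)
    have "(u, v) \<in> E1 \<longleftrightarrow> (\<phi> u, \<phi> v) \<in> E2"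
      using True att' sym uv by metis
    moreover have "(\<phi> u, \<phi> v) \<in> E \<longleftrightarrow> (\<phi> u, \<phi> v) \<in> E2"
      using True hub uv by (auto simp: E_def dest: K Fv)
    ultimately show ?thesis by simp
  next
    case False
    then have "\<phi> u \<notin> H" "\<phi> v \<notin> H"
      using nonhub uv by auto
    \<comment> \<open>The kept part of \<open>E2\<close> needs an endpoint in \<open>H\<close>, and
      \<open>F\<close> avoids the image of \<open>\<phi>\<close>.\<close>
    then have "(\<phi> u, \<phi> v) \<in> E \<longleftrightarrow> (\<phi> u, \<phi> v) \<in> K"
      using uv by (auto simp: E_def dest: Fv)
    also have "\<dots> \<longleftrightarrow> (u, v) \<in> E1"
      using False uv V1 inj_onD[OF inj] unfolding K_def mem_Collect_eq prod.inject by metis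
    finally show ?thesis by simp
  qed
  ultimately show ?thesis
    by blast
qed

section \<open>Well-quasi-ordering of the realizations\<close>

text \<open>A large entry at position \<open>v\<close> makes all entries at positions 0 to
  \<open>v\<close> large, which are at least \<open>N + 1\<close> entries.\<close>

lemma sorted_nth_le_of_few_large:
  fixes ds :: "nat list"
  assumes sorted: "sorted_wrt (\<ge>) ds" and few: "card {k. k < length ds \<and> ds ! k > N} \<le> N"
    and v: "N \<le> v" "v < length ds"
  shows "ds ! v \<le> N"
proof (rule ccontr)
  assume large: "\<not> ds ! v \<le> N"
  have "ds ! k > N" if "k \<le> v" for k
  proof (cases "k = v")
    case False
    then show ?thesis
      using sorted_wrt_nth_less[OF sorted, of k v] that v large by simp
  qed (use large in simp)
  then have "{..v} \<subseteq> {k. k < length ds \<and> ds ! k > N}"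
    using v by auto
  then have "card {..v} \<le> card {k. k < length ds \<and> ds ! k > N}"
    by (intro card_mono) simp_all
  then show False
    using few v by simp
qed

theorem theorem2:
  fixes Q :: "'q set" and le :: "'q \<Rightarrow> 'q \<Rightarrow> bool"
    and N :: nat and D :: "nat \<Rightarrow> (nat \<times> 'q) list"
  assumes "wqo_on Q le"
    and "N > 0"
    and "\<And>i. labelled_graphic_seq Q (D i)"
    and "\<And>i. card {k. k < length (D i) \<and> fst (D i ! k) > N} \<le> N"
  shows "\<exists>i j. i < j \<and> labelled_seq_le Q le (D i) (D j)"
proof -
  have graphic: "graphic (map fst (D i))" and labels: "set (map snd (D i)) \<subseteq> Q" for i
    using assms(3)[of i] by (auto simp: labelled_graphic_seq_def)
  have "\<forall>i. \<exists>E. graph_on {..<length (D i)} E \<and>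
      (\<forall>v<length (D i). card (E `` {v}) = fst (D i ! v))"
    using graphic_realization_on_positions[OF graphic] by simp
  then obtain E where E: "\<And>i. graph_on {..<length (D i)} (E i)"
    and deg: "\<And>i v. v < length (D i) \<Longrightarrow> card (E i `` {v}) = fst (D i ! v)"
    by metis
  define H where "H = {..<N}"
  define d where "d = (\<lambda>i v. card (E i `` {v} - H))"
  \<comment> \<open>This bound keeps the alphabet finite and limits the clique sizes that have to be
    counted.\<close>
  have d_le: "d i v \<le> N" if "v < length (D i)" "v \<notin> H" for i v
  proof -
    have "finite (E i `` {v})"
      using graph_on_Image_subset[OF E] by (meson finite_lessThan finite_subset)
    then have "d i v \<le> card (E i `` {v})"
      unfolding d_def by (intro card_mono) auto
    also have "\<dots> = fst (D i ! v)"
      using deg that by simp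
    also have "\<dots> \<le> N"
      using sorted_nth_le_of_few_large[of "map fst (D i)" N v] graphic[of i] assms(4)[of i] that
      by (auto simp: graphic_def H_def cong: conj_cong)
    finally show ?thesis .
  qed

  \<comment> \<open>\<open>min v N\<close> names a hub exactly and is \<open>N\<close> on all
    non-hubs, so equal colours make \<open>\<phi>\<close> fix hubs and map non-hubs to non-hubs. The
    entry 0 at hubs is a dummy: a hub may have arbitrarily many non-hub neighbours, and colours must
    stay in the finite set \<open>C\<close>.\<close>
  define colour where
    "colour = (\<lambda>i v. (min v N, E i `` {v} \<inter> H, if v \<in> H then 0 else d i v))"
  define word where "word = (\<lambda>i. map (\<lambda>v. (colour i v, snd (D i ! v))) [0..<length (D i)])"
  define cnt where "cnt = (\<lambda>i a. card {v. v < length (D i) \<and> v \<notin> H \<and> d i v = a})"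
  \<comment> \<open>Restriction to \<open>{..N}\<close> places the residue vectors in a finite
    function space, where equality can be forced by pigeonhole.\<close>
  define residues where "residues = (\<lambda>i. restrict (\<lambda>a. cnt i a mod Suc a) {..N})"
  define C where "C = {..N} \<times> Pow H \<times> {..N}"
  define P where "P = (\<lambda>x y :: (nat \<times> nat set \<times> nat) \<times> 'q. fst x = fst y \<and> le (snd x) (snd y))"
  have "finite C"
    by (simp add: C_def H_def)
  then have "wqo_on (lists (C \<times> Q)) (list_emb P)"
    using assms(1) unfolding P_def by (intro wqo_on_list_emb wqo_on_finite_Times)
  then have "wqo_on (Pi\<^sub>E {..N} (\<lambda>a. {..a}) \<times> lists (C \<times> Q))
      (\<lambda>x y. fst x = fst y \<and> list_emb P (snd x) (snd y))"
    by (intro wqo_on_finite_Times finite_PiE) auto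
  moreover have "(residues i, word i) \<in> Pi\<^sub>E {..N} (\<lambda>a. {..a}) \<times> lists (C \<times> Q)" for i
  proof -
    have "colour i v \<in> C" if "v < length (D i)" for v
      using d_le that by (auto simp: colour_def C_def)
    moreover have "snd (D i ! v) \<in> Q" if "v < length (D i)" for v
      using labels[of i] that by (auto dest: nth_mem)
    ultimately have "word i \<in> lists (C \<times> Q)"
      by (auto simp: word_def simp del: mem_Sigma_iff intro!: SigmaI)
    moreover have "residues i \<in> Pi\<^sub>E {..N} (\<lambda>a. {..a})"
      by (auto simp: residues_def less_Suc_eq_le[symmetric])
    ultimately show ?thesis by blast
  qed
  ultimately obtain i j where "i < j" and res: "residues i = residues j"
    and emb: "list_emb P (word i) (word j)"
    by (rule wqo_onE[where q = "\<lambda>i. (residues i, word i)"]) auto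

  define V1 where "V1 = {..<length (D i)}"
  define V2 where "V2 = {..<length (D j)}"
  obtain \<phi> where inj: "inj_on \<phi> V1" and into: "\<phi> ` V1 \<subseteq> V2"
    and P: "\<forall>v<length (D i). P (word i ! v) (word j ! \<phi> v)"
    using list_emb_index_map[OF emb] by (auto simp: V1_def V2_def word_def)
  have col: "colour i v = colour j (\<phi> v)" and lab: "le (snd (D i ! v)) (snd (D j ! \<phi> v))"
    if "v \<in> V1" for v
  proof -
    have "v < length (D i)" "\<phi> v < length (D j)"
      using that into by (auto simp: V1_def V2_def)
    then show "colour i v = colour j (\<phi> v)" "le (snd (D i ! v)) (snd (D j ! \<phi> v))"
      using P by (auto simp: P_def word_def)
  qed
  have hub: "\<phi> v = v" if "v \<in> V1" "v \<in> H" for v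
    using col[OF that(1)] that(2) by (auto simp: colour_def H_def min_def split: if_splits)
  have nonhub: "\<phi> v \<notin> H" if "v \<in> V1" "v \<notin> H" for v
    using col[OF that(1)] that(2) by (auto simp: colour_def H_def min_def split: if_splits)
  have att: "E i `` {v} \<inter> H = E j `` {\<phi> v} \<inter> H" if "v \<in> V1" for v
    using col[OF that] by (simp add: colour_def)
  have outer: "d i v = d j (\<phi> v)" if "v \<in> V1" "v \<notin> H" for v
    using col[OF that(1)] nonhub[OF that] that(2) by (simp add: colour_def)

  define R where "R = V2 - H - \<phi> ` V1"
  \<comment> \<open>For \<open>a \<le> N\<close> the vertices left over are those of
    \<open>S2\<close> without a copy of \<open>S1\<close>, and the two cardinalities agree modulo
    \<open>Suc a\<close> by \<open>res\<close>. For larger \<open>a\<close> none are left, by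
    \<open>d_le\<close>.\<close>
  have "Suc a dvd card {v \<in> R. d j v = a}" for a
  proof (cases "a \<le> N")
    case True
    define S1 where "S1 = {v \<in> V1. v \<notin> H \<and> d i v = a}"
    define S2 where "S2 = {v \<in> V2. v \<notin> H \<and> d j v = a}"
    have "S1 \<subseteq> V1" "finite S1" "finite S2"
      by (auto simp: S1_def S2_def V1_def V2_def)
    have sub: "\<phi> ` S1 \<subseteq> S2"
      using into nonhub outer by (auto simp: S1_def S2_def)
    have "v \<in> S1" if "v \<in> V1" "\<phi> v \<in> S2" for v
    proof -
      have "v \<notin> H"
        using hub[of v] that by (auto simp: S2_def)
      then show ?thesis
        using outer[of v] that by (auto simp: S1_def S2_def)
    qed
    then have "{v \<in> R. d j v = a} = S2 - \<phi> ` S1"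
      using \<open>S1 \<subseteq> V1\<close> by (auto simp: R_def S2_def)
    moreover have "card (\<phi> ` S1) = card S1"
      using inj \<open>S1 \<subseteq> V1\<close> by (intro card_image) (rule inj_on_subset)
    ultimately have "card {v \<in> R. d j v = a} = card S2 - card S1" and le: "card S1 \<le> card S2"
      using card_mono[OF \<open>finite S2\<close> sub] card_Diff_subset[OF _ sub] \<open>finite S1\<close> by simp_all
    moreover have "card S2 mod Suc a = card S1 mod Suc a"
      using fun_cong[OF res, of a] True
      by (simp add: residues_def cnt_def S1_def S2_def V1_def V2_def)
    ultimately show ?thesis
      using mod_eq_dvd_iff_nat[OF le, of "Suc a"] by simp
  next
    case False
    then have "{v \<in> R. d j v = a} = {}"
      using d_le by (auto simp: R_def V2_def)
    then show ?thesis
      by (simp only: card.empty dvd_0_right)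
  qed
  moreover have "finite R"
    by (simp add: R_def V2_def)
  ultimately obtain F where F: "graph_on R F" "\<forall>v\<in>R. card (F `` {v}) = d j v"
    using disjoint_cliques[of R "d j"] by blast
  have "\<exists>E'. graph_on V2 E' \<and> (\<forall>v\<in>V2. card (E' `` {v}) = card (E j `` {v})) \<and>
      (\<forall>u\<in>V1. \<forall>v\<in>V1. (u, v) \<in> E i \<longleftrightarrow> (\<phi> u, \<phi> v) \<in> E')"
  proof (rule rewire_along_embedding[where H = H and F = F])
    show "graph_on V1 (E i)" "graph_on V2 (E j)" "finite V1" "finite V2"
      using E by (simp_all add: V1_def V2_def)
    show "card (E i `` {v} - H) = card (E j `` {\<phi> v} - H)" if "v \<in> V1" "v \<notin> H" for v
      using outer[OF that] by (simp add: d_def)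
    show "graph_on (V2 - H - \<phi> ` V1) F"
      using F(1) by (simp add: R_def)
    show "card (F `` {v}) = card (E j `` {v} - H)" if "v \<in> V2 - H - \<phi> ` V1" for v
      using F(2) that by (simp add: R_def d_def)
  qed (fact inj into hub nonhub att)+
  then obtain E' where E': "graph_on V2 E'" "\<And>v. v \<in> V2 \<Longrightarrow> card (E' `` {v}) = fst (D j ! v)"
    and ind: "\<forall>u\<in>V1. \<forall>v\<in>V1. (u, v) \<in> E i \<longleftrightarrow> (\<phi> u, \<phi> v) \<in> E'"
    using deg by (auto simp: V2_def)

  \<comment> \<open>The realization chosen for \<open>D i\<close> is retained; only that of
    \<open>D j\<close> has been rewired.\<close>
  define G1 where "G1 = \<lparr>pverts = {..<length (D i)}, parcs = E i\<rparr>"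
  define G2 where "G2 = \<lparr>pverts = {..<length (D j)}, parcs = E'\<rparr>"
  have "labelled_induced_subgraph le G1 (\<lambda>v. snd (D i ! v)) G2 (\<lambda>v. snd (D j ! v))"
    unfolding labelled_induced_subgraph_def
    using inj into ind lab by (intro exI[of _ \<phi>]) (auto simp: G1_def G2_def V1_def V2_def)
  moreover note realizes_on_positions[OF labels E deg, of i, folded G1_def]
  moreover have "labelled_graph Q G2 (\<lambda>v. snd (D j ! v))" "realizes G2 (\<lambda>v. snd (D j ! v)) (D j)"
    using realizes_on_positions[OF labels[of j], of E'] E' by (auto simp: G2_def V2_def)
  ultimately have "labelled_seq_le Q le (D i) (D j)"
    unfolding labelled_seq_le_def by blast
  with \<open>i < j\<close> show ?thesis
    by blast
qed

end
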